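(* Let $m$ be a positive integer. For all integers $n,k\ge0$ we have \[ \mathrm{rac}_+^k(n,m)=\sum_{2i+j+r(m-1)+s+md=n-2k}(-1)^r\binom{i+k}{k}\binom{i}{j}\binom{j}{r}\binom{j+s-1}{s}\binom{k+j+d-1}{d}, \] \[ \mathrm{rac}_+^k(n,m)=\sum_{\substack{i_0+i_1+\cdots+i_{m-2}=j\\ 2i+j+i_1+2i_2+\cdots+(m-2)i_{m-2}+md=n-2k}}\binom{i+k}{k}\binom{i}{j}\binom{j}{i_0,\ldots,i_{m-2}}\binom{k+j+d-1}{d}, \] and \[ \mathrm{rac}^k(n,m)=\sum_{3i+j+r(m-1)+2s+dm=n-2k}(-1)^r\binom{i+k}{k}\binom{i+j}{j}\binom{i}{r}\binom{i+k+s-1}{s}\binom{i+k+d-1}{d}. \]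
   Context: A composition of $n$ is a finite sequence $\alpha=(\alpha_1,\ldots,\alpha_\ell)$ of positive integers with $\alpha_1+\cdots+\alpha_\ell=n$; the empty sequence ($\ell=0$) is the only composition of $0$. Two compositions of the same length $\ell$ are called equivalent if one is obtained from the other by a sequence of swaps, each swap exchanging the $i$th part and the $(\ell+1-i)$th part for some $1\le i\le\ell/2$. The number $\mathrm{rac}^k(n,m)$ is the number of equivalence classes of compositions $\alpha=(\alpha_1,\ldots,\alpha_\ell)$ of $n$ such that $\#\{1\le i\le \ell/2:\alpha_i\equiv\alpha_{\ell+1-i}\pmod m\}=k$. The number $\mathrm{rac}_+^k(n,m)$ is the number of those equivalence classes consisting of compositions for which either $\ell$ is even, or $\ell$ is odd and the middle part $\alpha_{(\ell+1)/2}$ is even. Convention for binomial coefficients, for integers $a,b$: $\binom{a}{b}=\frac{a!}{b!(a-b)!}$ if $a\ge b\ge1$; $\binom{a}{b}=1$ if $b=0$ (for every integer $a$, including $a=-1$); $\binom{a}{b}=0$ otherwise. $\binom{j}{i_0,\ldots,i_{m-2}}=\frac{j!}{i_0!\cdots i_{m-2}!}$ is the multinomial coefficient. All summation indices (including $i_0,\ldots,i_{m-2}$) range over nonnegative integers; only finitely many terms are nonzero. When $m=1$ the list $i_0,\ldots,i_{m-2}$ is empty with empty sum $0$, so in the second sum only $j=0$ occurs, with multinomial coefficient $1$. *)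

theory Defs
  imports
    "HOL-Library.Groups_Big_Fun"
    "HOL-Library.Multiset"
    "HOL-Number_Theory.Cong"
begin

definition composition :: "nat \<Rightarrow> nat list \<Rightarrow> bool" where
  "composition n \<alpha> \<longleftrightarrow> (\<forall>a\<in>set \<alpha>. 0 < a) \<and> sum_list \<alpha> = n"

text \<open>
  Parts are indexed from 0, so the \<open>i\<close>th part (\<open>1 \<le> i \<le> \<ell>/2\<close>) is \<open>\<alpha> ! (i - 1)\<close>
  and the part in the mirror position \<open>\<ell> + 1 - i\<close> is \<open>\<alpha> ! (\<ell> - i)\<close>.
  In terms of \<open>j = i - 1\<close> these are \<open>\<alpha> ! j\<close> and \<open>\<alpha> ! (\<ell> - 1 - j)\<close> with \<open>j < \<ell> div 2\<close>.
\<close>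

definition mirror_swap :: "nat \<Rightarrow> nat list \<Rightarrow> nat list" where
  "mirror_swap j \<alpha> =
     \<alpha>[j := \<alpha> ! (length \<alpha> - 1 - j), length \<alpha> - 1 - j := \<alpha> ! j]"

definition swap_equiv :: "(nat list \<times> nat list) set" where
  "swap_equiv = {(\<alpha>, mirror_swap j \<alpha>) | \<alpha> j. j < length \<alpha> div 2}\<^sup>*"

definition cong_pairs :: "nat \<Rightarrow> nat list \<Rightarrow> nat" where
  "cong_pairs m \<alpha> =
     card {j. j < length \<alpha> div 2 \<and> [\<alpha> ! j = \<alpha> ! (length \<alpha> - 1 - j)] (mod m)}"

definition rac_classes :: "nat \<Rightarrow> nat \<Rightarrow> nat \<Rightarrow> nat list set set" where
  "rac_classes k n m = {\<alpha>. composition n \<alpha> \<and> cong_pairs m \<alpha> = k} // swap_equiv"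

definition rac :: "nat \<Rightarrow> nat \<Rightarrow> nat \<Rightarrow> nat" where
  "rac k n m = card (rac_classes k n m)"

definition rac_plus :: "nat \<Rightarrow> nat \<Rightarrow> nat \<Rightarrow> nat" where
  "rac_plus k n m =
     card {C \<in> rac_classes k n m.
             \<forall>\<alpha>\<in>C. even (length \<alpha>) \<or> even (\<alpha> ! (length \<alpha> div 2))}"

text \<open>
  The convention \<open>binom a 0 = 1\<close> for all integers \<open>a\<close>, and \<open>binom a b = 0\<close> whenever
  \<open>b \<noteq> 0\<close> and not \<open>a \<ge> b \<ge> 1\<close>. For negative \<open>a\<close> this differs from \<^const>\<open>gbinomial\<close>.
\<close>

definition binom :: "int \<Rightarrow> int \<Rightarrow> int" where
  "binom a b =
     (if b = 0 then 1 else if 1 \<le> b \<and> b \<le> a then int (nat a choose nat b) else 0)"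

text \<open>The division is exact, since this is only used with \<open>sum_list is = j\<close>.\<close>

definition multinomial :: "nat \<Rightarrow> nat list \<Rightarrow> nat" where
  "multinomial j is = fact j div (\<Prod>i\<leftarrow>is. fact i)"

text \<open>
  The sum of \<open>f\<close> over a possibly infinite set on which only finitely many
  values of \<open>f\<close> are nonzero.
\<close>

definition finsupp_sum :: "('a \<Rightarrow> int) \<Rightarrow> 'a set \<Rightarrow> int" where
  "finsupp_sum f A = Sum_any (\<lambda>x. if x \<in> A then f x else 0)"

lemma mirror_swap_mirror_swap:
  assumes "j < length \<alpha> div 2"
  shows "mirror_swap j (mirror_swap j \<alpha>) = \<alpha>"
  using assms by (auto simp: mirror_swap_def nth_list_update intro!: nth_equalityI)

lemma equiv_swap_equiv: "equiv UNIV swap_equiv"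
proof -
  let ?R = "{(\<alpha>, mirror_swap j \<alpha>) | \<alpha> j. j < length \<alpha> div 2}"
  have len: "length (mirror_swap j \<alpha>) = length \<alpha>" for j \<alpha>
    by (simp add: mirror_swap_def)
  have "sym ?R"
  proof (rule symI)
    fix x y assume "(x, y) \<in> ?R"
    then obtain j where "j < length x div 2" "y = mirror_swap j x" by blast
    then have "x = mirror_swap j y" "j < length y div 2"
      using mirror_swap_mirror_swap len by simp_all
    then show "(y, x) \<in> ?R" by blast
  qed
  then have "sym swap_equiv"
    unfolding swap_equiv_def by (rule sym_rtrancl)
  then show ?thesis
    by (simp add: equiv_def refl_rtrancl trans_rtrancl swap_equiv_def)
qed

lemma composition_mirror_swap:
  assumes "j < length \<alpha> div 2" "composition n \<alpha>"
  shows "composition n (mirror_swap j \<alpha>)"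
proof -
  have "mset (mirror_swap j \<alpha>) = mset \<alpha>"
    unfolding mirror_swap_def using assms(1) by (intro mset_swap) auto
  then show ?thesis
    using assms(2) unfolding composition_def
    by (metis set_mset_mset sum_mset_sum_list)
qed

end

theory Submission
  imports Defs "HOL-Computational_Algebra.Formal_Power_Series"
begin

text \<open>
  A class of compositions is determined by the unordered pairs \<open>{\<alpha>\<^sub>i, \<alpha>\<^bsub>\<ell>+1-i\<^esub>}\<close>, listed
  from the outside inwards, together with the middle part when the length is odd.  These data
  can be chosen independently, so the generating functions multiply.  Write an unordered pair as
  \<open>{a, a + e}\<close> with \<open>a \<ge> 1\<close> and \<open>e \<ge> 0\<close>.  It has weight \<open>2a + e\<close>, and its two parts are congruent
  modulo \<open>m\<close> exactly if \<open>m\<close> divides \<open>e\<close>.  With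
  \<open>M = 1 / (1 - x\<^sup>2)\<close>, \<open>P = 1 / (1 - x\<^sup>m)\<close> and \<open>Q = 1 / (1 - x)\<close>, the congruent pairs are
  therefore counted by \<open>A = x\<^sup>2 M P\<close>, the other pairs by \<open>B = x\<^sup>2 M (Q - P)\<close>, and a possibly absent
  middle part by \<open>M\<close> if it has to be even and by \<open>Q\<close> if it is arbitrary.  A sequence of pairs
  with exactly \<open>k\<close> congruent ones contributes \<open>A\<^sup>k / (1 - B)\<^bsup>k+1\<^esup>\<close>, so that

    \<open>\<Sum>\<^sub>n rac\<^sub>+\<^sup>k(n, m) x\<^sup>n = M A\<^sup>k / (1 - B)\<^bsup>k+1\<^esup>\<close>   and   \<open>\<Sum>\<^sub>n rac\<^sup>k(n, m) x\<^sup>n = Q A\<^sup>k / (1 - B)\<^bsup>k+1\<^esup>\<close>.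

  This is \<open>canonical_fps_eq\<close>, in which classes are counted through canonical representatives:
  by \<open>card_rac_classes_middle\<close>, each class contains exactly one composition whose pairs all have
  the smaller part on the left.

  The sums in the theorem are expansions of these two series.  The key identity is
  \<open>Q - P = x (1 - x\<^bsup>m-1\<^esup>) Q P = (x + \<dots> + x\<^bsup>m-1\<^esup>) P\<close>.  For \<open>rac\<^sup>k\<close> one expands
  \<open>1 / (1 - B)\<^bsup>k+1\<^esup> = \<Sum>\<^sub>i (i+k choose k) B\<^sup>i\<close> with \<open>B = x\<^sup>3 (1 - x\<^bsup>m-1\<^esup>) Q M P\<close>, and then every factor of
  \<open>B\<^sup>i\<close>.  For \<open>rac\<^sub>+\<^sup>k\<close> the factor \<open>M\<close> of the middle part is first used to clear the denominator
  \<open>1 - x\<^sup>2\<close>: as \<open>(1 - B) / M = 1 - Z\<close> for \<open>Z = x\<^sup>2 (1 + Q - P)\<close>, the series equals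
  \<open>x\<^bsup>2k\<^esup> P\<^sup>k / (1 - Z)\<^bsup>k+1\<^esup>\<close>.  Expanding \<open>Z\<^sup>i\<close> binomially with \<open>Q - P\<close> written in the two ways above gives
  the first sum and, by the multinomial theorem, the second.

  On the side of the sums, each summation index is eliminated by one of two rules: an index with
  a factor \<open>(a+s-1 choose s)\<close> produces a power of a geometric series
  (\<open>sum_negative_binomial\<close>), and an index with a factor \<open>(j choose r)\<close> produces a power of a
  binomial (\<open>sum_binomial\<close>).
\<close>

unbundle fps_syntax

section \<open>Geometric series and their powers\<close>

text \<open>
  The series \<open>1 / (1 - Y)\<close>, as a composition: integer coefficients do not form a field, so an
  inverse has to be characterised by its product with \<open>1 - Y\<close>.  The composition is meaningful
  only if \<open>Y\<close> has zero constant term.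
\<close>

definition geometric :: "int fps \<Rightarrow> int fps" where
  "geometric Y = Abs_fps (\<lambda>_. 1) oo Y"

lemma geometric_mult_one_minus:
  assumes "Y $ 0 = 0"
  shows "geometric Y * (1 - Y) = 1"
proof -
  have "Abs_fps (\<lambda>_. 1) * (1 - fps_X) = (1 :: int fps)"
    by (rule fps_ext) (simp add: algebra_simps)
  then have "(Abs_fps (\<lambda>_. 1) * (1 - fps_X)) oo Y = 1"
    by simp
  then show ?thesis
    using assms by (simp add: geometric_def fps_compose_mult_distrib fps_compose_sub_distrib)
qed

lemma geometric_unique:
  assumes "Y $ 0 = 0" "G * (1 - Y) = 1"
  shows "G = geometric Y"
  by (metis assms geometric_mult_one_minus mult.assoc mult.commute mult.right_neutral)

text \<open>
  The generating functions below satisfy linear equations of this form, one unfolding step of a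
  sequence on the right-hand side.
\<close>

lemma geometric_solves:
  assumes "Y $ 0 = 0" "F = G + Y * F"
  shows "F = geometric Y * G"
proof -
  have "G = (1 - Y) * F"
    using assms(2) by (metis add_diff_cancel_right' left_diff_distrib mult_1)
  then have "geometric Y * G = (geometric Y * (1 - Y)) * F"
    by (simp add: mult.assoc)
  then show ?thesis
    using assms(1) by (simp add: geometric_mult_one_minus)
qed

lemma geometric_fps_X_power:
  assumes "0 < m"
  shows "Abs_fps (\<lambda>n. if m dvd n then 1 else 0) = geometric (fps_X ^ m)"
proof (rule geometric_unique)
  show "Abs_fps (\<lambda>n. if m dvd n then 1 else 0) * (1 - fps_X ^ m) = (1 :: int fps)"
  proof (rule fps_ext)
    fix n
    have "m dvd n - m \<longleftrightarrow> m dvd n" if "m \<le> n"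
      using that by (simp add: dvd_minus_self)
    then show "(Abs_fps (\<lambda>n. if m dvd n then 1 else 0) * (1 - fps_X ^ m)) $ n = (1 :: int fps) $ n"
      using assms by (auto simp: algebra_simps fps_X_power_mult_nth dvd_imp_le)
  qed
qed (use assms in simp)

lemma binom_of_nat: "binom (int a) (int b) = int (a choose b)"
  by (auto simp: binom_def binomial_eq_0)

text \<open>
  Multiplying by the all-ones series takes partial sums of the coefficients, so powers of it are
  governed by the hockey-stick identity.  The case \<open>a = 0\<close> agrees with the convention for \<^const>\<open>binom\<close>
  at a negative upper argument: the value is 1 for \<open>s = 0\<close>, and 0 otherwise.
\<close>

lemma geometric_power_nth:
  "Abs_fps (\<lambda>_. 1) ^ a $ s = binom (int a + int s - 1) (int s)"
proof (cases a)
  case 0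
  then show ?thesis by (simp add: binom_def)
next
  case (Suc b)
  have hockey_stick: "(\<Sum>i\<le>s. int ((b + i) choose i)) = int ((Suc b + s) choose s)" for b s
    using sum_choose_lower[of b s] by (metis add_Suc of_nat_sum)
  have "Abs_fps (\<lambda>_. 1 :: int) ^ Suc b $ s = int ((b + s) choose s)" for s
  proof (induction b arbitrary: s)
    case (Suc b)
    have "Abs_fps (\<lambda>_. 1) ^ Suc (Suc b) $ s
        = (\<Sum>i=0..s. Abs_fps (\<lambda>_. 1 :: int) ^ Suc b $ i)"
      by (simp add: fps_mult_nth power_Suc2[of _ "Suc b"] del: power_Suc)
    then show ?case
      using hockey_stick[of b s] by (simp add: Suc atLeast0AtMost del: power_Suc)
  qed simp
  from this[of s] show ?thesis
    using binom_of_nat[of "b + s" s] Suc by (simp del: power_Suc)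
qed

section \<open>Eliminating a summation index from a coefficient\<close>

text \<open>
  Summing \<open>h i\<close> times the coefficients of \<open>Y\<^sup>i F\<close> amounts to multiplying \<open>F\<close> by the composition
  of \<open>\<Sum>\<^sub>i h i x\<^sup>i\<close> with \<open>Y\<close>.  Cutting the sum off at \<open>n\<close> is harmless because \<open>Y\<^sup>i\<close> has no terms
  below degree \<open>i\<close>.
\<close>

lemma sum_power_mult_nth:
  fixes F Y :: "int fps"
  assumes "Y $ 0 = 0"
  shows "(\<Sum>i\<le>n. h i * (Y ^ i * F) $ n) = ((Abs_fps h oo Y) * F) $ n"
proof -
  have "((Abs_fps h oo Y) * F) $ n = (\<Sum>l=0..n. \<Sum>i\<le>n. h i * (Y ^ i $ l * F $ (n - l)))"
    unfolding fps_mult_nth fps_compose_nth sum_distrib_right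
    by (intro sum.cong refl sum.mono_neutral_cong_left)
       (auto simp: startsby_zero_power_prefix[OF assms])
  also have "\<dots> = (\<Sum>i\<le>n. h i * (Y ^ i * F) $ n)"
    by (subst sum.swap) (simp add: fps_mult_nth sum_distrib_left)
  finally show ?thesis ..
qed

lemma sum_negative_binomial:
  fixes F Y :: "int fps"
  assumes "Y $ 0 = 0"
  shows "(\<Sum>s\<le>n. binom (int a + int s - 1) (int s) * (Y ^ s * F) $ n) = (geometric Y ^ a * F) $ n"
proof -
  have "Abs_fps (\<lambda>s. binom (int a + int s - 1) (int s)) = Abs_fps (\<lambda>_. 1) ^ a"
    by (rule fps_ext) (simp add: geometric_power_nth)
  then show ?thesis
    using assms by (simp add: sum_power_mult_nth geometric_def fps_compose_power)
qed

lemma sum_negative_binomial_Suc: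
  fixes F Y :: "int fps"
  assumes "Y $ 0 = 0"
  shows "(\<Sum>i\<le>n. binom (int i + int k) (int k) * (Y ^ i * F) $ n) = (geometric Y ^ Suc k * F) $ n"
proof -
  have "binom (int i + int k) (int k) = binom (int (Suc k) + int i - 1) (int i)" for i
    using binom_of_nat[of "i + k" k] binom_of_nat[of "i + k" i] binomial_symmetric[of k "i + k"]
    by (simp add: add.commute)
  then show ?thesis
    using sum_negative_binomial[OF assms, where a = "Suc k" and F = F and n = n] by (simp only:)
qed

lemma sum_binomial:
  fixes F Y :: "int fps"
  assumes "j \<le> n"
  shows "(\<Sum>r\<le>n. binom (int j) (int r) * (Y ^ r * F) $ N) = ((1 + Y) ^ j * F) $ N"
proof -
  have "((1 + Y) ^ j * F) $ N = (\<Sum>r\<le>j. binom (int j) (int r) * (Y ^ r * F) $ N)"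
    by (simp add: add.commute[of 1] binomial_ring sum_distrib_right fps_sum_nth binom_of_nat mult.assoc
        flip: fps_of_nat)
  also have "\<dots> = (\<Sum>r\<le>n. binom (int j) (int r) * (Y ^ r * F) $ N)"
    using assms by (intro sum.mono_neutral_left) (auto simp: binom_of_nat)
  finally show ?thesis ..
qed

lemma sum_signed_binomial:
  fixes F Y :: "int fps"
  assumes "j \<le> n"
  shows "(\<Sum>r\<le>n. (- 1) ^ r * binom (int j) (int r) * (Y ^ r * F) $ N) = ((1 - Y) ^ j * F) $ N"
proof -
  have "(- 1) ^ r * binom (int j) (int r) * (Y ^ r * F) $ N
      = binom (int j) (int r) * ((- Y) ^ r * F) $ N" for r
    by (cases "even r") simp_all
  then show ?thesis
    using sum_binomial[OF assms, of "- Y" F N] by (simp only: diff_conv_add_uminus)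
qed

section \<open>Sums of finite support\<close>

lemma finsupp_sum_superset:
  assumes "finite B" "\<And>x. x \<in> A \<Longrightarrow> f x \<noteq> 0 \<Longrightarrow> x \<in> B"
  shows "finsupp_sum f A = (\<Sum>x\<in>B. if x \<in> A then f x else 0)"
  unfolding finsupp_sum_def using assms by (intro Sum_any.expand_superset) auto

section \<open>The multinomial theorem\<close>

lemma prod_list_fact_dvd: "(\<Prod>i\<leftarrow>is. fact i) dvd (fact (sum_list is) :: nat)"
proof (induction "is")
  case (Cons i "is")
  then have "fact i * (\<Prod>i\<leftarrow>is. fact i) dvd fact i * (fact (sum_list is) :: nat)"
    by (rule mult_dvd_mono[OF dvd_refl])
  also have "\<dots> dvd fact (i + sum_list is)"
    by (rule fact_fact_dvd_fact)
  finally show ?case by simp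
qed simp

text \<open>
  The division in \<^const>\<open>multinomial\<close> is exact here, by the preceding lemma; this makes the
  quotients of factorials cancel.
\<close>

lemma multinomial_append:
  assumes "i \<le> j" "sum_list is = j - i"
  shows "multinomial j (is @ [i]) = (j choose i) * multinomial (j - i) is"
proof -
  obtain c where c: "(fact (j - i) :: nat) = (\<Prod>i\<leftarrow>is. fact i) * c"
    using prod_list_fact_dvd[of "is"] assms(2) by (auto elim: dvdE)
  have "(fact j :: nat) = fact i * fact (j - i) * (j choose i)"
    using binomial_fact_lemma[OF assms(1)] by simp
  then have "(fact j :: nat) = (fact i * (\<Prod>i\<leftarrow>is. fact i)) * ((j choose i) * c)"
    using c by (simp add: ac_simps)
  moreover have "(\<Prod>i\<leftarrow>is. fact i :: nat) \<noteq> 0"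
    by (induction "is") auto
  ultimately show ?thesis
    using c by (simp add: multinomial_def mult.commute)
qed

text \<open>
  Induction on the number of variables: separating the last one leaves the binomial theorem.
\<close>

theorem multinomial_theorem:
  fixes x :: "nat \<Rightarrow> 'a :: comm_semiring_1"
  shows "(\<Sum>is\<in>natpermute j l. of_nat (multinomial j is) * (\<Prod>u<l. x u ^ (is ! u))) = (\<Sum>u<l. x u) ^ j"
proof (induction l arbitrary: j)
  case 0
  have "natpermute j 0 = (if j = 0 then {[]} else {})"
    by (auto simp: natpermute_def)
  then show ?case
    by (simp add: multinomial_def power_0_left)
next
  case (Suc l)
  have bij: "bij_betw (\<lambda>(i, is). is @ [i]) (SIGMA i:{..j}. natpermute (j - i) l) (natpermute j (Suc l))"
    by (rule bij_betw_byWitness[where f' = "\<lambda>is. (last is, butlast is)"])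
       (force simp: natpermute_def length_Suc_conv_rev)+
  have "(\<Sum>is\<in>natpermute j (Suc l). of_nat (multinomial j is) * (\<Prod>u<Suc l. x u ^ (is ! u)))
     = (\<Sum>(i, is)\<in>(SIGMA i:{..j}. natpermute (j - i) l). 
          of_nat (multinomial j (is @ [i])) * (\<Prod>u<Suc l. x u ^ ((is @ [i]) ! u)))"
    by (subst sum.reindex_bij_betw[OF bij, symmetric]) (simp add: case_prod_unfold)
  also have "\<dots> = (\<Sum>i\<le>j. \<Sum>is\<in>natpermute (j - i) l.
          of_nat (multinomial j (is @ [i])) * (\<Prod>u<Suc l. x u ^ ((is @ [i]) ! u)))"
    by (subst sum.Sigma) (auto simp: natpermute_finite)
  also have "\<dots> = (\<Sum>i\<le>j. of_nat (j choose i) * x l ^ i * (\<Sum>is\<in>natpermute (j - i) l.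
          of_nat (multinomial (j - i) is) * (\<Prod>u<l. x u ^ (is ! u))))"
    unfolding sum_distrib_left
  proof (intro sum.cong refl)
    fix i "is" assume "i \<in> {..j}" and "is": "is \<in> natpermute (j - i) l"
    then have "multinomial j (is @ [i]) = (j choose i) * multinomial (j - i) is"
      by (auto simp: natpermute_def intro: multinomial_append)
    moreover have "(\<Prod>u<Suc l. x u ^ ((is @ [i]) ! u)) = x l ^ i * (\<Prod>u<l. x u ^ (is ! u))"
      using "is" by (auto simp: natpermute_def nth_append mult.commute)
    ultimately show "of_nat (multinomial j (is @ [i])) * (\<Prod>u<Suc l. x u ^ ((is @ [i]) ! u))
       = of_nat (j choose i) * x l ^ i * (of_nat (multinomial (j - i) is) * (\<Prod>u<l. x u ^ (is ! u)))"
      by (simp add: ac_simps)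
  qed
  also have "\<dots> = (x l + (\<Sum>u<l. x u)) ^ j"
    by (simp add: Suc binomial_ring)
  finally show ?case
    by (simp add: add.commute)
qed

section \<open>Canonical compositions\<close>

definition canonical :: "nat list \<Rightarrow> bool" where
  "canonical \<alpha> \<longleftrightarrow> (\<forall>j < length \<alpha> div 2. \<alpha> ! j \<le> \<alpha> ! (length \<alpha> - 1 - j))"

definition middle_satisfies :: "(nat \<Rightarrow> bool) \<Rightarrow> nat list \<Rightarrow> bool" where
  "middle_satisfies Q \<alpha> \<longleftrightarrow> even (length \<alpha>) \<or> Q (\<alpha> ! (length \<alpha> div 2))"

text \<open>
  Pairs of mirror parts are nested, so compositions are decomposed by removing the first and the
  last part together.
\<close>

lemma outer_cases [case_names empty single outer]:
  obtains "\<alpha> = []" | a where "\<alpha> = [a]" | a \<beta> b where "\<alpha> = a # \<beta> @ [b]"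
  by (cases \<alpha>; cases "tl \<alpha>" rule: rev_cases) auto

lemma outer_induct [case_names empty single outer]:
  assumes "P []" "\<And>a. P [a]" "\<And>a \<beta> b. P \<beta> \<Longrightarrow> P (a # \<beta> @ [b])"
  shows "P \<alpha>"
proof (induction \<alpha> rule: length_induct)
  case (1 \<alpha>)
  then show ?case
    using assms by (cases \<alpha> rule: outer_cases) auto
qed

lemma nth_outer:
  assumes "j < length \<beta>"
  shows "(\<beta> @ [b]) ! j = \<beta> ! j"
    and "(a # \<beta> @ [b]) ! (length \<beta> - j) = \<beta> ! (length \<beta> - Suc j)"
  using assms by (auto simp: nth_append nth_Cons')

lemma canonical_outer: "canonical (a # \<beta> @ [b]) \<longleftrightarrow> a \<le> b \<and> canonical \<beta>"
proof -
  have "canonical (a # \<beta> @ [b]) \<longleftrightarrow> (\<forall>j < Suc (length \<beta> div 2).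
      (a # \<beta> @ [b]) ! j \<le> (a # \<beta> @ [b]) ! (Suc (length \<beta>) - j))"
    by (simp add: canonical_def)
  then show ?thesis
    unfolding All_less_Suc2 canonical_def by (simp add: nth_outer cong: conj_cong)
qed

lemma cong_pairs_outer:
  "cong_pairs m (a # \<beta> @ [b]) = (if [a = b] (mod m) then 1 else 0) + cong_pairs m \<beta>"
proof -
  let ?J = "{j. j < length \<beta> div 2 \<and> [\<beta> ! j = \<beta> ! (length \<beta> - 1 - j)] (mod m)}"
  have "{j. j < Suc (length \<beta> div 2) \<and>
      [(a # \<beta> @ [b]) ! j = (a # \<beta> @ [b]) ! (Suc (length \<beta>) - j)] (mod m)}
    = (if [a = b] (mod m) then {0} else {}) \<union> Suc ` ?J" (is "?L = ?R")
  proof (rule set_eqI)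
    fix j show "j \<in> ?L \<longleftrightarrow> j \<in> ?R"
      by (cases j) (auto simp: nth_outer)
  qed
  then have "cong_pairs m (a # \<beta> @ [b]) = card ((if [a = b] (mod m) then {0} else {}) \<union> Suc ` ?J)"
    by (simp add: cong_pairs_def)
  also have "\<dots> = (if [a = b] (mod m) then 1 else 0) + card ?J"
    by (subst card_Un_disjoint) (auto simp: card_image)
  finally show ?thesis
    by (simp add: cong_pairs_def)
qed

lemma middle_satisfies_outer: "middle_satisfies Q (a # \<beta> @ [b]) \<longleftrightarrow> middle_satisfies Q \<beta>"
proof (cases "even (length \<beta>)")
  case False
  then have "length \<beta> div 2 < length \<beta>" by (cases \<beta>) auto
  with False nth_outer(1)[OF this, of b] show ?thesis
    by (simp add: middle_satisfies_def)
qed (simp add: middle_satisfies_def)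

lemma composition_outer:
  "composition n (a # \<beta> @ [b]) \<longleftrightarrow> 0 < a \<and> 0 < b \<and> a + b \<le> n \<and> composition (n - (a + b)) \<beta>"
  by (auto simp: composition_def)

section \<open>Canonical compositions as class representatives\<close>

text \<open>
  Each of these is unchanged by a single swap; length and pairs together determine the class.  Here
  the unordered pair at the middle position of a composition of odd length is a singleton, so
  this position is fixed.
\<close>

lemma swap_equiv_invariants:
  assumes "(\<alpha>, \<beta>) \<in> swap_equiv"
  shows "length \<beta> = length \<alpha>"
    and "\<And>i. i < length \<alpha> \<Longrightarrow>
      {\<beta> ! i, \<beta> ! (length \<alpha> - 1 - i)} = {\<alpha> ! i, \<alpha> ! (length \<alpha> - 1 - i)}"
    and "composition n \<alpha> \<Longrightarrow> composition n \<beta>"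
proof -
  have "length \<beta> = length \<alpha> \<and>
      (\<forall>i < length \<alpha>. {\<beta> ! i, \<beta> ! (length \<alpha> - 1 - i)} = {\<alpha> ! i, \<alpha> ! (length \<alpha> - 1 - i)}) \<and>
      (composition n \<alpha> \<longrightarrow> composition n \<beta>)" for n
    using assms unfolding swap_equiv_def
  proof (induction rule: rtrancl_induct)
    case (step \<beta> \<gamma>)
    then obtain j where j: "j < length \<beta> div 2" and \<gamma>: "\<gamma> = mirror_swap j \<beta>"
      by blast
    have "{\<gamma> ! i, \<gamma> ! (length \<beta> - 1 - i)} = {\<beta> ! i, \<beta> ! (length \<beta> - 1 - i)}"
      if "i < length \<beta>" for i
      using j that unfolding \<gamma> mirror_swap_def by (auto simp: nth_list_update)
    moreover have "length \<gamma> = length \<beta>"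
      by (simp add: \<gamma> mirror_swap_def)
    ultimately show ?case
      using step.IH j by (auto simp: \<gamma> composition_mirror_swap)
  qed auto
  then show "length \<beta> = length \<alpha>"
    and "\<And>i. i < length \<alpha> \<Longrightarrow>
      {\<beta> ! i, \<beta> ! (length \<alpha> - 1 - i)} = {\<alpha> ! i, \<alpha> ! (length \<alpha> - 1 - i)}"
    and "composition n \<alpha> \<Longrightarrow> composition n \<beta>"
    by blast+
qed

lemma cong_pairs_swap_equiv:
  assumes "(\<alpha>, \<beta>) \<in> swap_equiv"
  shows "cong_pairs m \<beta> = cong_pairs m \<alpha>"
proof -
  have "[\<beta> ! j = \<beta> ! (length \<alpha> - 1 - j)] (mod m) \<longleftrightarrow> [\<alpha> ! j = \<alpha> ! (length \<alpha> - 1 - j)] (mod m)"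
    if "j < length \<alpha> div 2" for j
  proof -
    have "j < length \<alpha>"
      using that by simp
    from swap_equiv_invariants(2)[OF assms this] show ?thesis
      by (auto simp: doubleton_eq_iff cong_def)
  qed
  then show ?thesis
    using swap_equiv_invariants(1)[OF assms] by (auto simp: cong_pairs_def intro!: arg_cong[of _ _ card])
qed

lemma middle_satisfies_swap_equiv:
  assumes "(\<alpha>, \<beta>) \<in> swap_equiv"
  shows "middle_satisfies Q \<beta> \<longleftrightarrow> middle_satisfies Q \<alpha>"
proof (cases "even (length \<alpha>)")
  case False
  then have "length \<alpha> div 2 < length \<alpha>" "length \<alpha> - 1 - length \<alpha> div 2 = length \<alpha> div 2"
    by presburger+
  then show ?thesis
    using swap_equiv_invariants[OF assms] unfolding middle_satisfies_def by fastforce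
qed (use swap_equiv_invariants(1)[OF assms] in \<open>simp add: middle_satisfies_def\<close>)

lemma mirror_swap_in_swap_equiv:
  assumes "j < length \<alpha> div 2"
  shows "(\<alpha>, mirror_swap j \<alpha>) \<in> swap_equiv"
proof -
  have "(\<alpha>, mirror_swap j \<alpha>) \<in> {(\<alpha>, mirror_swap j \<alpha>) | \<alpha> j. j < length \<alpha> div 2}"
    using assms by (intro CollectI exI[of _ \<alpha>] exI[of _ j] conjI refl)
  then show ?thesis
    unfolding swap_equiv_def by (rule r_into_rtrancl)
qed

lemma swap_equiv_outer:
  assumes "(\<alpha>, \<beta>) \<in> swap_equiv"
  shows "(a # \<alpha> @ [b], a # \<beta> @ [b]) \<in> swap_equiv"
  using assms unfolding swap_equiv_def
proof (induction rule: rtrancl_induct)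
  case (step \<beta> \<gamma>)
  then obtain j where j: "j < length \<beta> div 2" and \<gamma>: "\<gamma> = mirror_swap j \<beta>"
    by blast
  moreover from j have "length \<beta> - j = Suc (length \<beta> - Suc j)" "j < length \<beta>"
    by auto
  ultimately have "a # \<gamma> @ [b] = mirror_swap (Suc j) (a # \<beta> @ [b])"
    by (auto simp: mirror_swap_def nth_append list_update_append)
  moreover have "Suc j < length (a # \<beta> @ [b]) div 2"
    using j by simp
  ultimately have "(a # \<beta> @ [b], a # \<gamma> @ [b]) \<in> swap_equiv"
    using mirror_swap_in_swap_equiv by metis
  with step.IH show ?case
    unfolding swap_equiv_def by (rule rtrancl_trans)
qed auto

lemma swap_equiv_outer_swap: "(a # \<alpha> @ [b], b # \<alpha> @ [a]) \<in> swap_equiv"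
proof -
  have "mirror_swap 0 (a # \<alpha> @ [b]) = b # \<alpha> @ [a]"
    by (simp add: mirror_swap_def)
  moreover have "0 < length (a # \<alpha> @ [b]) div 2"
    by simp
  ultimately show ?thesis
    using mirror_swap_in_swap_equiv by metis
qed

lemma canonical_representative_exists: "\<exists>\<beta>. canonical \<beta> \<and> (\<alpha>, \<beta>) \<in> swap_equiv"
proof (induction \<alpha> rule: outer_induct)
  case (outer a \<alpha> b)
  then obtain \<beta> where "canonical \<beta>" "(\<alpha>, \<beta>) \<in> swap_equiv"
    by blast
  then have "canonical (min a b # \<beta> @ [max a b])" "(a # \<alpha> @ [b], a # \<beta> @ [b]) \<in> swap_equiv"
    by (auto simp: canonical_outer swap_equiv_outer)
  moreover have "(a # \<beta> @ [b], min a b # \<beta> @ [max a b]) \<in> swap_equiv"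
    using swap_equiv_outer_swap[of a \<beta> b] by (auto simp: min_def max_def swap_equiv_def)
  ultimately show ?case
    using equiv_swap_equiv by (meson equivE transE)
next
  case empty
  show ?case
    by (intro exI[of _ "[]"]) (simp add: canonical_def swap_equiv_def)
next
  case (single a)
  show ?case
    by (intro exI[of _ "[a]"]) (simp add: canonical_def swap_equiv_def)
qed

lemma canonical_representative_unique:
  assumes "(\<alpha>, \<beta>) \<in> swap_equiv" "canonical \<alpha>" "canonical \<beta>"
  shows "\<alpha> = \<beta>"
proof (rule nth_equalityI)
  fix i assume i: "i < length \<alpha>"
  note inv = swap_equiv_invariants[OF assms(1)]
  have half: "\<beta> ! j = \<alpha> ! j \<and> \<beta> ! (length \<alpha> - 1 - j) = \<alpha> ! (length \<alpha> - 1 - j)"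
    if "j < length \<alpha> div 2" for j
  proof -
    have "\<alpha> ! j \<le> \<alpha> ! (length \<alpha> - 1 - j)" "\<beta> ! j \<le> \<beta> ! (length \<alpha> - 1 - j)"
      using assms(2,3) inv(1) that by (auto simp: canonical_def)
    moreover have "j < length \<alpha>"
      using that by simp
    ultimately show ?thesis
      using inv(2)[of j] by (auto simp: doubleton_eq_iff)
  qed
  consider "i < length \<alpha> div 2" | "length \<alpha> - 1 - i < length \<alpha> div 2" | "length \<alpha> - 1 - i = i"
    using i by linarith
  then show "\<alpha> ! i = \<beta> ! i"
  proof cases
    case 2
    then show ?thesis
      using half[of "length \<alpha> - 1 - i"] i by simp
  next
    case 3
    then show ?thesis
      using inv(2)[OF i] by simp
  qed (simp add: half)
qed (simp add: swap_equiv_invariants(1)[OF assms(1)])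

lemma card_quotient_transversal:
  assumes "equiv UNIV R" "T \<subseteq> S"
    and "\<And>x. x \<in> S \<Longrightarrow> \<exists>t\<in>T. (x, t) \<in> R"
    and "\<And>t u. t \<in> T \<Longrightarrow> u \<in> T \<Longrightarrow> (t, u) \<in> R \<Longrightarrow> t = u"
  shows "card (S // R) = card T"
proof -
  have "bij_betw (\<lambda>t. R `` {t}) T (S // R)"
  proof (rule bij_betw_imageI)
    show "inj_on (\<lambda>t. R `` {t}) T"
      using assms(1,4) by (auto simp: inj_on_def eq_equiv_class)
    show "(\<lambda>t. R `` {t}) ` T = S // R"
    proof
      show "(\<lambda>t. R `` {t}) ` T \<subseteq> S // R"
        using assms(2) by (auto intro: quotientI)
      show "S // R \<subseteq> (\<lambda>t. R `` {t}) ` T"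
      proof
        fix C assume "C \<in> S // R"
        then obtain x where "x \<in> S" "C = R `` {x}" by (rule quotientE)
        then show "C \<in> (\<lambda>t. R `` {t}) ` T"
          using assms(3)[of x] equiv_class_eq[OF assms(1)] by auto
      qed
    qed
  qed
  then show ?thesis
    by (metis bij_betw_same_card)
qed

definition canonical_compositions :: "(nat \<Rightarrow> bool) \<Rightarrow> nat \<Rightarrow> nat \<Rightarrow> nat \<Rightarrow> nat list set" where
  "canonical_compositions Q m k n =
     {\<alpha>. composition n \<alpha> \<and> cong_pairs m \<alpha> = k \<and> middle_satisfies Q \<alpha> \<and> canonical \<alpha>}"

text \<open>
  Length and middle part are constant on a class, so a condition on the middle part selects whole
  classes, and each of them contains exactly one canonical composition.
\<close>

lemma card_rac_classes_middle:
  "card {C \<in> rac_classes k n m. \<forall>\<alpha>\<in>C. middle_satisfies Q \<alpha>} = card (canonical_compositions Q m k n)"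
proof -
  let ?S = "{\<alpha>. composition n \<alpha> \<and> cong_pairs m \<alpha> = k \<and> middle_satisfies Q \<alpha>}"
  have "(\<forall>\<beta>\<in>swap_equiv `` {\<alpha>}. middle_satisfies Q \<beta>) \<longleftrightarrow> middle_satisfies Q \<alpha>" for \<alpha>
    using middle_satisfies_swap_equiv equiv_class_self[OF equiv_swap_equiv, of \<alpha>] by blast
  then have "{C \<in> rac_classes k n m. \<forall>\<alpha>\<in>C. middle_satisfies Q \<alpha>} = ?S // swap_equiv"
    unfolding rac_classes_def quotient_def by auto
  moreover have "card (?S // swap_equiv) = card (canonical_compositions Q m k n)"
  proof (rule card_quotient_transversal[OF equiv_swap_equiv])
    fix \<alpha> assume \<alpha>: "\<alpha> \<in> ?S"
    obtain \<beta> where "canonical \<beta>" and \<beta>: "(\<alpha>, \<beta>) \<in> swap_equiv"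
      using canonical_representative_exists by blast
    with \<alpha> have "\<beta> \<in> canonical_compositions Q m k n"
      by (auto simp: canonical_compositions_def swap_equiv_invariants(3)[OF \<beta>]
          cong_pairs_swap_equiv[OF \<beta>] middle_satisfies_swap_equiv[OF \<beta>])
    with \<beta> show "\<exists>\<beta>\<in>canonical_compositions Q m k n. (\<alpha>, \<beta>) \<in> swap_equiv"
      by blast
  qed (auto simp: canonical_compositions_def intro: canonical_representative_unique)
  ultimately show ?thesis
    by simp
qed

lemma finite_canonical_compositions: "finite (canonical_compositions Q m k n)"
proof (rule finite_subset)
  have "length \<alpha> \<le> sum_list \<alpha>" if "\<forall>a\<in>set \<alpha>. 0 < a" for \<alpha> :: "nat list"
    using that by (induction \<alpha>) (auto simp: Suc_le_eq add_strict_increasing)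
  then show "canonical_compositions Q m k n \<subseteq> {\<alpha>. set \<alpha> \<subseteq> {..n} \<and> length \<alpha> \<le> n}"
    by (auto simp: canonical_compositions_def composition_def member_le_sum_list)
qed (simp add: finite_lists_length_le)

section \<open>The generating function of the canonical compositions\<close>

text \<open>
  Absence of a middle part is counted by the constant coefficient.
\<close>

definition middle_fps :: "(nat \<Rightarrow> bool) \<Rightarrow> int fps" where
  "middle_fps Q = Abs_fps (\<lambda>n. if n = 0 \<or> Q n then 1 else 0)"

definition canonical_fps :: "(nat \<Rightarrow> bool) \<Rightarrow> nat \<Rightarrow> nat \<Rightarrow> int fps" where
  "canonical_fps Q m k = Abs_fps (\<lambda>n. int (card (canonical_compositions Q m k n)))"

text \<open>
  Either there are no pairs, or the outermost pair consists of \<open>a + 1\<close> on the left and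
  \<open>a + 1 + e\<close> on the right, and a canonical composition remains inside.  The shift by one makes
  \<open>a\<close> range over all natural numbers.
\<close>

lemma canonical_compositions_decompose:
  "canonical_compositions Q m k n =
     (if k \<noteq> 0 then {} else if n = 0 then {[]} else if Q n then {[n]} else {}) \<union>
     (\<Union>(a, e) \<in> {..n} \<times> {..n}. (\<lambda>\<beta>. Suc a # \<beta> @ [Suc a + e]) `
        {\<beta>. 2 + 2 * a + e \<le> n \<and> (m dvd e \<longrightarrow> k \<noteq> 0) \<and>
          \<beta> \<in> canonical_compositions Q m (if m dvd e then k - 1 else k) (n - (2 + 2 * a + e))})"
  (is "?C = ?B \<union> ?O")
proof (rule set_eqI)
  fix \<alpha>
  show "\<alpha> \<in> ?C \<longleftrightarrow> \<alpha> \<in> ?B \<union> ?O"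
  proof (cases \<alpha> rule: outer_cases)
    case empty
    then show ?thesis
      by (auto simp: canonical_compositions_def canonical_def composition_def cong_pairs_def
          middle_satisfies_def)
  next
    case (single a)
    then show ?thesis
      by (auto simp: canonical_compositions_def canonical_def composition_def cong_pairs_def
          middle_satisfies_def)
  next
    case (outer a \<beta> b)
    have cong: "[c = c + e] (mod m) \<longleftrightarrow> m dvd e" for c e
      by (metis add.right_neutral cong_0_iff cong_add_lcancel_nat cong_sym_eq)
    have "\<alpha> \<in> ?O" if "\<alpha> \<in> ?C"
    proof (rule UN_I)
      from that show "(a - 1, b - a) \<in> {..n} \<times> {..n}"
        by (auto simp: outer canonical_compositions_def composition_outer)
      show "\<alpha> \<in> (case (a - 1, b - a) of (a, e) \<Rightarrow> (\<lambda>\<beta>. Suc a # \<beta> @ [Suc a + e]) `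
        {\<beta>. 2 + 2 * a + e \<le> n \<and> (m dvd e \<longrightarrow> k \<noteq> 0) \<and>
          \<beta> \<in> canonical_compositions Q m (if m dvd e then k - 1 else k) (n - (2 + 2 * a + e))})"
        unfolding outer prod.case
      proof (rule image_eqI)
        from that have "0 < a" "a \<le> b"
          by (auto simp: outer canonical_compositions_def composition_outer canonical_outer)
        then have "2 + 2 * (a - 1) + (b - a) = a + b" "[a = b] (mod m) \<longleftrightarrow> m dvd b - a"
          using cong[of a "b - a"] by auto
        with that show "\<beta> \<in> {\<beta>. 2 + 2 * (a - 1) + (b - a) \<le> n \<and>
            (m dvd b - a \<longrightarrow> k \<noteq> 0) \<and>
            \<beta> \<in> canonical_compositions Q m (if m dvd b - a then k - 1 else k)
                 (n - (2 + 2 * (a - 1) + (b - a)))}"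
          by (auto simp: outer canonical_compositions_def composition_outer canonical_outer
              cong_pairs_outer middle_satisfies_outer)
        show "a # \<beta> @ [b] = Suc (a - 1) # \<beta> @ [Suc (a - 1) + (b - a)]"
          using \<open>0 < a\<close> \<open>a \<le> b\<close> by simp
      qed
    qed
    moreover have "\<alpha> \<in> ?C" if "\<alpha> \<in> ?O"
    proof -
      from that obtain c e where ce: "a = Suc c" "b = a + e" "2 + 2 * c + e \<le> n"
        "m dvd e \<longrightarrow> k \<noteq> 0"
        and \<beta>: "\<beta> \<in> canonical_compositions Q m (if m dvd e then k - 1 else k) (n - (2 + 2 * c + e))"
        by (auto simp: outer split: if_splits)
      have weight: "2 + 2 * c + e = a + b"
        using ce by simp
      have "a + b \<le> n" "0 < a" "a \<le> b" "[a = b] (mod m) \<longleftrightarrow> m dvd e"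
        using ce cong[of a e] by auto
      with ce(4) \<beta>[unfolded weight]
      show ?thesis
        by (auto simp: outer canonical_compositions_def composition_outer canonical_outer
            cong_pairs_outer middle_satisfies_outer split: if_splits)
    qed
    moreover have "\<alpha> \<notin> ?B"
      by (simp add: outer)
    ultimately show ?thesis
      by blast
  qed
qed

text \<open>
  The decomposition by the outermost pair as an equation of generating functions: the factor
  \<open>x\<^sup>2 / (1 - x\<^sup>2)\<close> accounts for the smaller part of the pair, and the difference of its parts is
  counted by \<open>1 / (1 - x\<^sup>m)\<close> if it is divisible by \<open>m\<close> and by the complementary series if not.
\<close>

lemma canonical_fps_unfold:
  assumes "0 < m"
  shows "canonical_fps Q m k = (if k = 0 then middle_fps Q else 0) +
    fps_X ^ 2 * geometric (fps_X ^ 2) *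
      (geometric (fps_X ^ m) * (if k = 0 then 0 else canonical_fps Q m (k - 1)) +
       (geometric fps_X - geometric (fps_X ^ m)) * canonical_fps Q m k)"
    (is "?C = ?B + fps_X ^ 2 * _ * (?P * ?C' + (?Q - ?P) * _)")
proof (rule fps_ext)
  fix n
  let ?B' = "if k \<noteq> 0 then {} else if n = 0 then {[]} else if Q n then {[n]} else {}"
  let ?I = "\<lambda>(a, e). {\<beta>. 2 + 2 * a + e \<le> n \<and> (m dvd e \<longrightarrow> k \<noteq> 0) \<and>
          \<beta> \<in> canonical_compositions Q m (if m dvd e then k - 1 else k) (n - (2 + 2 * a + e))}"
  let ?O = "\<lambda>(a, e). (\<lambda>\<beta>. Suc a # \<beta> @ [Suc a + e]) ` ?I (a, e)"
  define multiple non_multiple :: "nat \<Rightarrow> int"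
    where "multiple e = (if m dvd e then 1 else 0)" and "non_multiple e = 1 - multiple e" for e
  have fin: "finite (?O p)" for p
    by (auto simp: case_prod_unfold intro!: finite_subset[OF _ finite_canonical_compositions] finite_imageI)
  \<comment> \<open>The number of canonical compositions with outermost pair \<open>a + 1\<close>, \<open>a + 1 + e\<close>, as a coefficient;
    it is zero if the weight of the pair exceeds \<open>n\<close>.\<close>
  have card_O: "int (card (?O (a, e))) =
      multiple e * (fps_X ^ e * (fps_X ^ (2 + 2 * a) * ?C')) $ n +
      non_multiple e * (fps_X ^ e * (fps_X ^ (2 + 2 * a) * ?C)) $ n" for a e
  proof -
    define w where "w = 2 + 2 * a + e"
    have "card (?O (a, e)) = card (?I (a, e))"
      unfolding prod.case by (rule card_image) (auto simp: inj_on_def)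
    also have "\<dots> = (if w \<le> n \<and> (m dvd e \<longrightarrow> k \<noteq> 0)
        then card (canonical_compositions Q m (if m dvd e then k - 1 else k) (n - w)) else 0)"
      unfolding w_def by auto
    finally have card_w: "card (?O (a, e)) = \<dots>" .
    have shift: "fps_X ^ e * (fps_X ^ (2 + 2 * a) * F) = fps_X ^ w * F" for F :: "int fps"
      by (simp only: w_def power_add mult_ac)
    show ?thesis
      unfolding card_w shift by (simp add: multiple_def non_multiple_def fps_X_power_mult_nth canonical_fps_def)
  qed
  have multiple_fps: "Abs_fps multiple = ?P"
    unfolding multiple_def by (rule geometric_fps_X_power[OF assms])
  have "Abs_fps (\<lambda>_. 1 :: int) = ?Q"
    by (simp add: geometric_def)
  with multiple_fps have non_multiple_fps: "Abs_fps non_multiple = ?Q - ?P"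
    unfolding non_multiple_def by (metis (mono_tags, lifting) fps_ext fps_nth_Abs_fps fps_sub_nth)
  have "finite ?B'" and disjoint: "?B' \<inter> (\<Union>p\<in>{..n} \<times> {..n}. ?O p) = {}"
    by auto
  have "int (card (canonical_compositions Q m k n))
      = int (card ?B') + int (card (\<Union>p\<in>{..n} \<times> {..n}. ?O p))"
    unfolding canonical_compositions_decompose[of Q m k n]
    using fin disjoint by (subst card_Un_disjoint) auto
  also have "int (card ?B') = ?B $ n"
    by (auto simp: middle_fps_def)
  also have "int (card (\<Union>p\<in>{..n} \<times> {..n}. ?O p)) = (\<Sum>p\<in>{..n} \<times> {..n}. int (card (?O p)))"
    using fin by (subst card_UN_disjoint) auto
  also have "\<dots> = (\<Sum>a\<le>n. \<Sum>e\<le>n. int (card (?O (a, e))))"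
    by (rule sum.cartesian_product')
  also have "\<dots> = (\<Sum>a\<le>n. 1 * ((fps_X ^ 2) ^ a * (fps_X ^ 2 * (?P * ?C' + (?Q - ?P) * ?C))) $ n)"
  proof (rule sum.cong[OF refl])
    fix a
    have "(\<Sum>e\<le>n. int (card (?O (a, e)))) =
      (?P * (fps_X ^ (2 + 2 * a) * ?C')) $ n + ((?Q - ?P) * (fps_X ^ (2 + 2 * a) * ?C)) $ n"
      unfolding card_O sum.distrib
      by (simp only: sum_power_mult_nth fps_X_nth zero_neq_one if_False fps_compose_fps_X multiple_fps non_multiple_fps)
    moreover have power: "fps_X ^ (2 + 2 * a) = fps_X ^ 2 * (fps_X ^ 2 :: int fps) ^ a"
      by (simp only: power_add power_mult)
    have "?P * (fps_X ^ (2 + 2 * a) * ?C') + (?Q - ?P) * (fps_X ^ (2 + 2 * a) * ?C)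
      = (fps_X ^ 2) ^ a * (fps_X ^ 2 * (?P * ?C' + (?Q - ?P) * ?C))"
      unfolding power by (simp only: algebra_simps)
    ultimately show "(\<Sum>e\<le>n. int (card (?O (a, e)))) =
      1 * ((fps_X ^ 2) ^ a * (fps_X ^ 2 * (?P * ?C' + (?Q - ?P) * ?C))) $ n"
      by (simp only: fps_add_nth[symmetric] mult_1)
  qed
  also have "\<dots> = (geometric (fps_X ^ 2) * (fps_X ^ 2 * (?P * ?C' + (?Q - ?P) * ?C))) $ n"
    by (subst sum_power_mult_nth) (simp_all add: geometric_def)
  finally show "?C $ n = (?B + fps_X ^ 2 * geometric (fps_X ^ 2) * (?P * ?C' + (?Q - ?P) * ?C)) $ n"
    by (simp add: canonical_fps_def mult.assoc mult.left_commute)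
qed

theorem canonical_fps_eq:
  assumes "0 < m"
  shows "canonical_fps Q m k = middle_fps Q
    * (fps_X ^ 2 * geometric (fps_X ^ 2) * geometric (fps_X ^ m)) ^ k
    * geometric (fps_X ^ 2 * geometric (fps_X ^ 2) * (geometric fps_X - geometric (fps_X ^ m)))
        ^ Suc k"
    (is "_ = _ * ?A ^ k * geometric ?B ^ Suc k")
proof -
  have B: "?B $ 0 = 0"
    by simp
  show ?thesis
  proof (induction k)
    case 0
    have "canonical_fps Q m 0 = middle_fps Q + ?B * canonical_fps Q m 0"
      by (subst canonical_fps_unfold[OF assms]) simp
    from geometric_solves[OF B this] show ?case
      by (simp add: mult_ac)
  next
    case (Suc k)
    have "canonical_fps Q m (Suc k) = ?A * canonical_fps Q m k + ?B * canonical_fps Q m (Suc k)"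
      by (subst canonical_fps_unfold[OF assms]) (simp add: algebra_simps)
    from geometric_solves[OF B this] show ?case
      by (simp add: Suc mult_ac)
  qed
qed

section \<open>Expanding the generating functions\<close>

text \<open>
  Differences \<open>e\<close> that are not divisible by \<open>m\<close>: the right-hand side counts all differences minus
  the divisible ones, the left-hand side writes \<open>e\<close> as a nonzero residue plus a multiple of \<open>m\<close>.
\<close>

lemma one_minus_fps_X_power_geometric:
  assumes "0 < m"
  shows "fps_X * (1 - fps_X ^ (m - 1)) * geometric fps_X * geometric (fps_X ^ m)
       = geometric fps_X - geometric (fps_X ^ m)"
proof -
  have Q: "geometric fps_X * (1 - fps_X) = 1" and P: "geometric (fps_X ^ m) * (1 - fps_X ^ m) = 1"
    using assms by (auto intro!: geometric_mult_one_minus)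
  have "fps_X * (1 - fps_X ^ (m - 1)) = (1 - fps_X ^ m) - (1 - fps_X :: int fps)"
    using assms by (cases m) (simp_all add: algebra_simps)
  then have "fps_X * (1 - fps_X ^ (m - 1)) * geometric fps_X * geometric (fps_X ^ m)
    = geometric fps_X * (geometric (fps_X ^ m) * (1 - fps_X ^ m))
    - geometric (fps_X ^ m) * (geometric fps_X * (1 - fps_X))"
    by (simp add: algebra_simps)
  then show ?thesis
    by (simp add: Q P)
qed

lemma sum_fps_X_power_geometric: "(\<Sum>u<l. fps_X ^ u) = (1 - fps_X ^ l) * geometric fps_X"
proof -
  have "geometric fps_X * (1 - fps_X) = 1"
    by (rule geometric_mult_one_minus) simp
  moreover have "(1 - fps_X ^ l) = (1 - fps_X) * (\<Sum>u<l. fps_X ^ u :: int fps)"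
    by (rule one_diff_power_eq)
  ultimately show ?thesis
    by (metis mult.assoc mult.commute mult_1)
qed

text \<open>
  The entry of \<open>is\<close> at position \<open>u\<close> counts how often \<open>x\<^sup>u\<close> is chosen when
  \<open>(1 + x + \<dots> + x\<^bsup>l-1\<^esup>)\<^sup>j\<close> is multiplied out.
\<close>

lemma sum_multinomial_mult_nth:
  fixes F :: "int fps"
  shows "(\<Sum>is\<in>natpermute j l. int (multinomial j is) * (F * fps_X ^ (a + (\<Sum>u<l. u * is ! u))) $ n)
    = ((\<Sum>u<l. fps_X ^ u) ^ j * F * fps_X ^ a) $ n"
proof -
  have "int (multinomial j is) * (F * fps_X ^ (a + (\<Sum>u<l. u * is ! u))) $ n
      = (of_nat (multinomial j is) * (\<Prod>u<l. (fps_X ^ u) ^ (is ! u)) * F * fps_X ^ a) $ n" for "is"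
  proof -
    have "F * fps_X ^ (a + (\<Sum>u<l. u * is ! u)) = (\<Prod>u<l. (fps_X ^ u) ^ (is ! u)) * F * fps_X ^ a"
      by (simp add: power_add power_sum power_mult mult_ac)
    then show ?thesis
      by (simp only: mult.assoc) (simp flip: fps_of_nat)
  qed
  then show ?thesis
    by (simp add: sum_distrib_right fps_sum_nth flip: multinomial_theorem)
qed

text \<open>
  The terms of the sum vanish outside a finite box.  The equation constraining the indices is
  then absorbed into the \<open>n\<close>-th coefficient of a monomial, and the indices are eliminated from
  the innermost to the outermost.  The index \<open>r\<close> is bounded through the coefficient
  \<open>(j choose r)\<close>, because for \<open>m = 1\<close> the constraint does not involve it.
\<close>

lemma rac_plus_sum_eq_coefficient:
  assumes "0 < m"
  shows "finsupp_sum
             (\<lambda>(i, j, r, s, d).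
                (- 1) ^ r * binom (int i + int k) (int k) * binom (int i) (int j)
                  * binom (int j) (int r) * binom (int j + int s - 1) (int s)
                  * binom (int k + int j + int d - 1) (int d))
             {(i :: nat, j :: nat, r :: nat, s :: nat, d :: nat).
                2 * int i + int j + int r * (int m - 1) + int s + int m * int d
                  = int n - 2 * int k}
    = (geometric (fps_X ^ 2 *
          (1 + fps_X * (1 - fps_X ^ (m - 1)) * geometric fps_X * geometric (fps_X ^ m))) ^ Suc k
        * (geometric (fps_X ^ m) ^ k * fps_X ^ (2 * k))) $ n"
    (is "finsupp_sum ?f ?A = (geometric (_ * (1 + fps_X * ?U * ?Q * ?P)) ^ _ * _) $ n")
proof -
  define w where "w i j r s d = 2 * i + j + (m - 1) * r + s + m * d + 2 * k" for i j r s d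
  \<comment> \<open>Moving \<open>2k\<close> to the other side turns the constraint into an equation of natural numbers.\<close>
  have A: "(i, j, r, s, d) \<in> ?A \<longleftrightarrow> w i j r s d = n" for i j r s d
  proof -
    have "(i, j, r, s, d) \<in> ?A \<longleftrightarrow> int (w i j r s d) = int n"
      using assms by (auto simp: w_def mult.commute)
    then show ?thesis
      by simp
  qed
  have "finsupp_sum ?f ?A = (\<Sum>x\<in>{..n} \<times> {..n} \<times> {..n} \<times> {..n} \<times> {..n}. if x \<in> ?A then ?f x else 0)"
  proof (rule finsupp_sum_superset)
    fix x assume x: "x \<in> ?A" "?f x \<noteq> 0"
    obtain i j r s d where eq: "x = (i, j, r, s, d)"
      by (cases x)
    have "d \<le> m * d"
      using assms by simp
    moreover have "r \<le> j"
      using x(2) by (auto simp: eq binom_of_nat intro: ccontr)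
    moreover have "w i j r s d = n"
      using x(1) unfolding eq A .
    ultimately have "i \<le> n" "j \<le> n" "r \<le> n" "s \<le> n" "d \<le> n"
      unfolding w_def by linarith+
    then show "x \<in> {..n} \<times> {..n} \<times> {..n} \<times> {..n} \<times> {..n}"
      by (simp add: eq)
  qed simp
  also have "\<dots> = (\<Sum>(i, j, r, s, d)\<in>{..n} \<times> {..n} \<times> {..n} \<times> {..n} \<times> {..n}.
      ?f (i, j, r, s, d) * (fps_X ^ w i j r s d) $ n)"
  proof (rule sum.cong[OF refl])
    fix x
    show "(if x \<in> ?A then ?f x else 0) =
        (case x of (i, j, r, s, d) \<Rightarrow> ?f (i, j, r, s, d) * (fps_X ^ w i j r s d) $ n)"
      by (cases x) (simp only: A prod.case, simp)
  qed
  also have "\<dots> = (\<Sum>i\<le>n. binom (int i + int k) (int k) * (\<Sum>j\<le>n. binom (int i) (int j) *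
      (\<Sum>r\<le>n. (- 1) ^ r * binom (int j) (int r) * (\<Sum>s\<le>n. binom (int j + int s - 1) (int s) *
      (\<Sum>d\<le>n. binom (int k + int j + int d - 1) (int d) * (fps_X ^ w i j r s d) $ n)))))"
    by (simp only: sum_distrib_left sum.cartesian_product' prod.case mult_ac)
  also have "\<dots> = (\<Sum>i\<le>n. binom (int i + int k) (int k) * (\<Sum>j\<le>n. binom (int i) (int j) *
      (\<Sum>r\<le>n. (- 1) ^ r * binom (int j) (int r) * (\<Sum>s\<le>n. binom (int j + int s - 1) (int s) *
      (?P ^ (k + j) * fps_X ^ w i j r s 0) $ n))))"
  proof -
    have "(\<Sum>d\<le>n. binom (int k + int j + int d - 1) (int d) * (fps_X ^ w i j r s d) $ n)
      = (?P ^ (k + j) * fps_X ^ w i j r s 0) $ n" for i j r s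
      using sum_negative_binomial[of "fps_X ^ m" "k + j" "fps_X ^ w i j r s 0" n] assms
      by (simp add: w_def power_add power_mult mult_ac[where ?'a = "int fps"])
    then show ?thesis
      by simp
  qed
  also have "\<dots> = (\<Sum>i\<le>n. binom (int i + int k) (int k) * (\<Sum>j\<le>n. binom (int i) (int j) *
      (\<Sum>r\<le>n. (- 1) ^ r * binom (int j) (int r) * 
        (?Q ^ j * ?P ^ (k + j) * fps_X ^ w i j r 0 0) $ n)))"
  proof -
    have "(\<Sum>s\<le>n. binom (int j + int s - 1) (int s) * (?P ^ (k + j) * fps_X ^ w i j r s 0) $ n)
      = (?Q ^ j * ?P ^ (k + j) * fps_X ^ w i j r 0 0) $ n" for i j r
      using sum_negative_binomial[of "fps_X" j "?P ^ (k + j) * fps_X ^ w i j r 0 0" n]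
      by (simp add: w_def power_add mult_ac)
    then show ?thesis
      by simp
  qed
  also have "\<dots> = (\<Sum>i\<le>n. binom (int i + int k) (int k) * (\<Sum>j\<le>n. binom (int i) (int j) *
        (?U ^ j * ?Q ^ j * ?P ^ (k + j) * fps_X ^ w i j 0 0 0) $ n))"
  proof -
    have "(\<Sum>r\<le>n. (- 1) ^ r * binom (int j) (int r) * (?Q ^ j * ?P ^ (k + j) * fps_X ^ w i j r 0 0) $ n)
      = (?U ^ j * ?Q ^ j * ?P ^ (k + j) * fps_X ^ w i j 0 0 0) $ n" if "j \<le> n" for i j
      using sum_signed_binomial[OF that, of "fps_X ^ (m - 1)" "?Q ^ j * ?P ^ (k + j) * fps_X ^ w i j 0 0 0" n]
      by (simp add: w_def power_add power_mult mult_ac[where ?'a = "int fps"])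
    then show ?thesis
      by (intro sum.cong arg_cong2[where f = "(*)"] refl) simp
  qed
  also have "\<dots> = (\<Sum>i\<le>n. binom (int i + int k) (int k) *
        ((1 + fps_X * ?U * ?Q * ?P) ^ i * ?P ^ k * fps_X ^ w i 0 0 0 0) $ n)"
  proof -
    have "(\<Sum>j\<le>n. binom (int i) (int j) * (?U ^ j * ?Q ^ j * ?P ^ (k + j) * fps_X ^ w i j 0 0 0) $ n)
      = ((1 + fps_X * ?U * ?Q * ?P) ^ i * ?P ^ k * fps_X ^ w i 0 0 0 0) $ n" if "i \<le> n" for i
      using sum_binomial[OF that, of "fps_X * ?U * ?Q * ?P" "?P ^ k * fps_X ^ w i 0 0 0 0" n]
      by (simp add: w_def power_add power_mult_distrib mult_ac)
    then show ?thesis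
      by (intro sum.cong arg_cong2[where f = "(*)"] refl) simp
  qed
  also have "\<dots> = (geometric (fps_X ^ 2 * (1 + fps_X * ?U * ?Q * ?P)) ^ Suc k * (?P ^ k * fps_X ^ (2 * k))) $ n"
    using sum_negative_binomial_Suc[of "fps_X ^ 2 * (1 + fps_X * ?U * ?Q * ?P)" k "?P ^ k * fps_X ^ (2 * k)" n]
    by (simp add: w_def power_add power_mult power_mult_distrib mult_ac[where ?'a = "int fps"])
  finally show ?thesis .
qed


text \<open>
  In the term for \<open>i\<close>, the index \<open>j\<close> expands \<open>1 / (1 - x)\<^bsup>i+1\<^esup>\<close>, where one factor is
  the middle part and the others come from the \<open>i\<close> incongruent pairs; \<open>s\<close> and \<open>d\<close> expand
  the denominators \<open>1 - x\<^sup>2\<close> and \<open>1 - x\<^sup>m\<close> of all \<open>i + k\<close> pairs.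
\<close>

lemma rac_sum_eq_coefficient:
  assumes "0 < m"
  shows "finsupp_sum
             (\<lambda>(i, j, r, s, d).
                (- 1) ^ r * binom (int i + int k) (int k) * binom (int i + int j) (int j)
                  * binom (int i) (int r) * binom (int i + int k + int s - 1) (int s)
                  * binom (int i + int k + int d - 1) (int d))
             {(i :: nat, j :: nat, r :: nat, s :: nat, d :: nat).
                3 * int i + int j + int r * (int m - 1) + 2 * int s + int d * int m
                  = int n - 2 * int k}
    = (geometric (fps_X ^ 3 * (1 - fps_X ^ (m - 1)) *
          geometric fps_X * geometric (fps_X ^ 2) * geometric (fps_X ^ m)) ^ Suc k
        * (geometric fps_X * geometric (fps_X ^ 2) ^ k * geometric (fps_X ^ m) ^ k * fps_X ^ (2 * k))) $ n"
    (is "finsupp_sum ?f ?A = (geometric (_ * ?U * ?Q * ?M * ?P) ^ _ * _) $ n")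
proof -
  define w where "w i j r s d = 3 * i + j + (m - 1) * r + 2 * s + m * d + 2 * k" for i j r s d
  \<comment> \<open>Moving \<open>2k\<close> to the other side turns the constraint into an equation of natural numbers.\<close>
  have A: "(i, j, r, s, d) \<in> ?A \<longleftrightarrow> w i j r s d = n" for i j r s d
  proof -
    have "(i, j, r, s, d) \<in> ?A \<longleftrightarrow> int (w i j r s d) = int n"
      using assms by (auto simp: w_def mult.commute)
    then show ?thesis
      by simp
  qed
  have "finsupp_sum ?f ?A = (\<Sum>x\<in>{..n} \<times> {..n} \<times> {..n} \<times> {..n} \<times> {..n}. if x \<in> ?A then ?f x else 0)"
  proof (rule finsupp_sum_superset)
    fix x assume x: "x \<in> ?A" "?f x \<noteq> 0"
    obtain i j r s d where eq: "x = (i, j, r, s, d)"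
      by (cases x)
    have "d \<le> m * d"
      using assms by simp
    moreover have "r \<le> i"
      using x(2) by (auto simp: eq binom_of_nat intro: ccontr)
    moreover have "w i j r s d = n"
      using x(1) unfolding eq A .
    ultimately have "i \<le> n" "j \<le> n" "r \<le> n" "s \<le> n" "d \<le> n"
      unfolding w_def by linarith+
    then show "x \<in> {..n} \<times> {..n} \<times> {..n} \<times> {..n} \<times> {..n}"
      by (simp add: eq)
  qed simp
  also have "\<dots> = (\<Sum>(i, j, r, s, d)\<in>{..n} \<times> {..n} \<times> {..n} \<times> {..n} \<times> {..n}.
      ?f (i, j, r, s, d) * (fps_X ^ w i j r s d) $ n)"
  proof (rule sum.cong[OF refl])
    fix x
    show "(if x \<in> ?A then ?f x else 0) =
        (case x of (i, j, r, s, d) \<Rightarrow> ?f (i, j, r, s, d) * (fps_X ^ w i j r s d) $ n)"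
      by (cases x) (simp only: A prod.case, simp)
  qed
  also have "\<dots> = (\<Sum>i\<le>n. binom (int i + int k) (int k) * (\<Sum>j\<le>n. binom (int i + int j) (int j) *
      (\<Sum>r\<le>n. (- 1) ^ r * binom (int i) (int r) * (\<Sum>s\<le>n. binom (int i + int k + int s - 1) (int s) *
      (\<Sum>d\<le>n. binom (int i + int k + int d - 1) (int d) * (fps_X ^ w i j r s d) $ n)))))"
    by (simp only: sum_distrib_left sum.cartesian_product' prod.case mult_ac)
  also have "\<dots> = (\<Sum>i\<le>n. binom (int i + int k) (int k) * (\<Sum>j\<le>n. binom (int i + int j) (int j) *
      (\<Sum>r\<le>n. (- 1) ^ r * binom (int i) (int r) * (\<Sum>s\<le>n. binom (int i + int k + int s - 1) (int s) *
      (?P ^ (i + k) * fps_X ^ w i j r s 0) $ n))))"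
  proof -
    have "(\<Sum>d\<le>n. binom (int i + int k + int d - 1) (int d) * (fps_X ^ w i j r s d) $ n)
      = (?P ^ (i + k) * fps_X ^ w i j r s 0) $ n" for i j r s
      using sum_negative_binomial[of "fps_X ^ m" "i + k" "fps_X ^ w i j r s 0" n] assms
      by (simp add: w_def power_add power_mult mult_ac[where ?'a = "int fps"])
    then show ?thesis
      by simp
  qed
  also have "\<dots> = (\<Sum>i\<le>n. binom (int i + int k) (int k) * (\<Sum>j\<le>n. binom (int i + int j) (int j) *
      (\<Sum>r\<le>n. (- 1) ^ r * binom (int i) (int r) *
        (?M ^ (i + k) * ?P ^ (i + k) * fps_X ^ w i j r 0 0) $ n)))"
  proof -
    have "(\<Sum>s\<le>n. binom (int i + int k + int s - 1) (int s) * (?P ^ (i + k) * fps_X ^ w i j r s 0) $ n)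
      = (?M ^ (i + k) * ?P ^ (i + k) * fps_X ^ w i j r 0 0) $ n" for i j r
      using sum_negative_binomial[of "fps_X ^ 2" "i + k" "?P ^ (i + k) * fps_X ^ w i j r 0 0" n]
      by (simp add: w_def power_add power_mult mult_ac[where ?'a = "int fps"])
    then show ?thesis
      by simp
  qed
  also have "\<dots> = (\<Sum>i\<le>n. binom (int i + int k) (int k) * (\<Sum>j\<le>n. binom (int i + int j) (int j) *
        (?U ^ i * ?M ^ (i + k) * ?P ^ (i + k) * fps_X ^ w i j 0 0 0) $ n))"
  proof -
    have "(\<Sum>r\<le>n. (- 1) ^ r * binom (int i) (int r) * (?M ^ (i + k) * ?P ^ (i + k) * fps_X ^ w i j r 0 0) $ n)
      = (?U ^ i * ?M ^ (i + k) * ?P ^ (i + k) * fps_X ^ w i j 0 0 0) $ n" if "i \<le> n" for i j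
      using sum_signed_binomial[OF that, of "fps_X ^ (m - 1)"
          "?M ^ (i + k) * ?P ^ (i + k) * fps_X ^ w i j 0 0 0" n]
      by (simp add: w_def power_add power_mult mult_ac[where ?'a = "int fps"])
    then show ?thesis
      by (intro sum.cong arg_cong2[where f = "(*)"] refl) simp
  qed
  also have "\<dots> = (\<Sum>i\<le>n. binom (int i + int k) (int k) *
        (?Q ^ Suc i * ?U ^ i * ?M ^ (i + k) * ?P ^ (i + k) * fps_X ^ w i 0 0 0 0) $ n)"
  proof -
    have "(\<Sum>j\<le>n. binom (int i + int j) (int j) * (?U ^ i * ?M ^ (i + k) * ?P ^ (i + k) * fps_X ^ w i j 0 0 0) $ n)
      = (?Q ^ Suc i * ?U ^ i * ?M ^ (i + k) * ?P ^ (i + k) * fps_X ^ w i 0 0 0 0) $ n" for i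
      using sum_negative_binomial[of fps_X "Suc i"
          "?U ^ i * ?M ^ (i + k) * ?P ^ (i + k) * fps_X ^ w i 0 0 0 0" n]
      by (simp add: w_def power_add mult_ac)
    then show ?thesis
      by simp
  qed
  also have "\<dots> = (geometric (fps_X ^ 3 * ?U * ?Q * ?M * ?P) ^ Suc k
      * (?Q * ?M ^ k * ?P ^ k * fps_X ^ (2 * k))) $ n"
    using sum_negative_binomial_Suc[of "fps_X ^ 3 * ?U * ?Q * ?M * ?P" k
        "?Q * ?M ^ k * ?P ^ k * fps_X ^ (2 * k)" n]
    by (simp add: w_def power_add power_mult power_mult_distrib mult_ac[where ?'a = "int fps"])
  finally show ?thesis .
qed

text \<open>
  Here \<open>(1 + x + \<dots> + x\<^bsup>m-2\<^esup>)\<^sup>j\<close> comes from the multinomial coefficients.  It equals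
  \<open>(1 - x\<^bsup>m-1\<^esup>)\<^sup>j / (1 - x)\<^sup>j\<close>, so the result is the same as for the signed sum.
\<close>

lemma rac_plus_multinomial_sum_eq_coefficient:
  assumes "0 < m"
  shows "finsupp_sum
             (\<lambda>(i, j, is, d).
                binom (int i + int k) (int k) * binom (int i) (int j)
                  * int (multinomial j is)
                  * binom (int k + int j + int d - 1) (int d))
             {(i :: nat, j :: nat, is :: nat list, d :: nat).
                length is = m - 1 \<and> sum_list is = j \<and>
                2 * int i + int j + int (\<Sum>u<m - 1. u * is ! u) + int m * int d
                  = int n - 2 * int k}
    = (geometric (fps_X ^ 2 *
          (1 + fps_X * (1 - fps_X ^ (m - 1)) * geometric fps_X * geometric (fps_X ^ m))) ^ Suc k
        * (geometric (fps_X ^ m) ^ k * fps_X ^ (2 * k))) $ n"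
    (is "finsupp_sum ?f ?A = (geometric (_ * (1 + fps_X * ?U * ?Q * ?P)) ^ _ * _) $ n")
proof -
  let ?S = "\<lambda>is. \<Sum>u<m - 1. u * is ! u"
  let ?B = "SIGMA i:{..n}. SIGMA j:{..n}. natpermute j (m - 1) \<times> {..n}"
  define w where "w i j d = 2 * i + j + m * d + 2 * k" for i j d
  have A: "(i, j, is, d) \<in> ?A \<longleftrightarrow> is \<in> natpermute j (m - 1) \<and> w i j d + ?S is = n" for i j "is" d
  proof -
    have "(i, j, is, d) \<in> ?A \<longleftrightarrow> is \<in> natpermute j (m - 1) \<and> int (w i j d + ?S is) = int n"
      by (auto simp: w_def natpermute_def)
    then show ?thesis
      by (simp only: of_nat_eq_iff)
  qed
  have "finsupp_sum ?f ?A = (\<Sum>x\<in>?B. if x \<in> ?A then ?f x else 0)"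
  proof (rule finsupp_sum_superset)
    fix x assume x: "x \<in> ?A" "?f x \<noteq> 0"
    obtain i j "is" d where eq: "x = (i, j, is, d)"
      by (cases x)
    have "d \<le> m * d"
      using assms by simp
    moreover have "is": "is \<in> natpermute j (m - 1)" and "w i j d + ?S is = n"
      using x(1) unfolding eq A by auto
    ultimately have "i \<le> n" "j \<le> n" "d \<le> n"
      unfolding w_def by linarith+
    with "is" show "x \<in> ?B"
      by (simp add: eq)
  qed (simp add: natpermute_finite)
  also have "\<dots> = (\<Sum>(i, j, is, d)\<in>?B. ?f (i, j, is, d) * (fps_X ^ (w i j d + ?S is)) $ n)"
  proof (rule sum.cong[OF refl])
    fix x assume "x \<in> ?B"
    then show "(if x \<in> ?A then ?f x else 0) =
        (case x of (i, j, is, d) \<Rightarrow> ?f (i, j, is, d) * (fps_X ^ (w i j d + ?S is)) $ n)"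
      by (cases x) (simp only: A prod.case, auto)
  qed
  also have "\<dots> = (\<Sum>i\<le>n. binom (int i + int k) (int k) * (\<Sum>j\<le>n. binom (int i) (int j) *
      (\<Sum>is\<in>natpermute j (m - 1). int (multinomial j is) *
      (\<Sum>d\<le>n. binom (int k + int j + int d - 1) (int d) * (fps_X ^ (w i j d + ?S is)) $ n))))"
    by (simp add: sum_distrib_left sum.cartesian_product sum.Sigma natpermute_finite mult_ac)
      (simp only: case_prod_beta mult_ac)
  also have "\<dots> = (\<Sum>i\<le>n. binom (int i + int k) (int k) * (\<Sum>j\<le>n. binom (int i) (int j) *
      (\<Sum>is\<in>natpermute j (m - 1). int (multinomial j is) *
      (?P ^ (k + j) * fps_X ^ (w i j 0 + ?S is)) $ n)))"
  proof -
    have "(\<Sum>d\<le>n. binom (int k + int j + int d - 1) (int d) * (fps_X ^ (w i j d + ?S is)) $ n)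
      = (?P ^ (k + j) * fps_X ^ (w i j 0 + ?S is)) $ n" for i j "is"
      using sum_negative_binomial[of "fps_X ^ m" "k + j" "fps_X ^ (w i j 0 + ?S is)" n] assms
      by (simp add: w_def power_add power_mult mult_ac[where ?'a = "int fps"])
    then show ?thesis
      by simp
  qed
  also have "\<dots> = (\<Sum>i\<le>n. binom (int i + int k) (int k) * (\<Sum>j\<le>n. binom (int i) (int j) *
        ((?U * ?Q) ^ j * ?P ^ (k + j) * fps_X ^ w i j 0) $ n))"
    by (simp only: sum_multinomial_mult_nth sum_fps_X_power_geometric)
  also have "\<dots> = (\<Sum>i\<le>n. binom (int i + int k) (int k) *
        ((1 + fps_X * ?U * ?Q * ?P) ^ i * ?P ^ k * fps_X ^ w i 0 0) $ n)"
  proof -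
    have "(\<Sum>j\<le>n. binom (int i) (int j) * ((?U * ?Q) ^ j * ?P ^ (k + j) * fps_X ^ w i j 0) $ n)
      = ((1 + fps_X * ?U * ?Q * ?P) ^ i * ?P ^ k * fps_X ^ w i 0 0) $ n" if "i \<le> n" for i
      using sum_binomial[OF that, of "fps_X * ?U * ?Q * ?P" "?P ^ k * fps_X ^ w i 0 0" n]
      by (simp add: w_def power_add power_mult_distrib mult_ac)
    then show ?thesis
      by (intro sum.cong arg_cong2[where f = "(*)"] refl) simp
  qed
  also have "\<dots> = (geometric (fps_X ^ 2 * (1 + fps_X * ?U * ?Q * ?P)) ^ Suc k * (?P ^ k * fps_X ^ (2 * k))) $ n"
    using sum_negative_binomial_Suc[of "fps_X ^ 2 * (1 + fps_X * ?U * ?Q * ?P)" k "?P ^ k * fps_X ^ (2 * k)" n]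
    by (simp add: w_def power_add power_mult power_mult_distrib mult_ac[where ?'a = "int fps"])
  finally show ?thesis .
qed

theorem theorem7p1:
  fixes m n k :: nat
  assumes "0 < m"
  shows "int (rac_plus k n m) =
           finsupp_sum
             (\<lambda>(i, j, r, s, d).
                (- 1) ^ r * binom (int i + int k) (int k) * binom (int i) (int j)
                  * binom (int j) (int r) * binom (int j + int s - 1) (int s)
                  * binom (int k + int j + int d - 1) (int d))
             {(i :: nat, j :: nat, r :: nat, s :: nat, d :: nat).
                2 * int i + int j + int r * (int m - 1) + int s + int m * int d
                  = int n - 2 * int k}
       \<and> int (rac_plus k n m) =
           finsupp_sum
             (\<lambda>(i, j, is, d).
                binom (int i + int k) (int k) * binom (int i) (int j)
                  * int (multinomial j is)
                  * binom (int k + int j + int d - 1) (int d))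
             {(i :: nat, j :: nat, is :: nat list, d :: nat).
                length is = m - 1 \<and> sum_list is = j \<and>
                2 * int i + int j + int (\<Sum>u<m - 1. u * is ! u) + int m * int d
                  = int n - 2 * int k}
       \<and> int (rac k n m) =
           finsupp_sum
             (\<lambda>(i, j, r, s, d).
                (- 1) ^ r * binom (int i + int k) (int k) * binom (int i + int j) (int j)
                  * binom (int i) (int r) * binom (int i + int k + int s - 1) (int s)
                  * binom (int i + int k + int d - 1) (int d))
             {(i :: nat, j :: nat, r :: nat, s :: nat, d :: nat).
                3 * int i + int j + int r * (int m - 1) + 2 * int s + int d * int m
                  = int n - 2 * int k}"
proof -
  let ?M = "geometric (fps_X ^ 2)" and ?P = "geometric (fps_X ^ m)" and ?Q = "geometric fps_X"
  let ?B = "fps_X ^ 2 * ?M * (?Q - ?P)"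
  let ?Z = "fps_X ^ 2 * (1 + fps_X * (1 - fps_X ^ (m - 1)) * ?Q * ?P)"
  have rac_plus: "int (rac_plus k n m) = canonical_fps even m k $ n"
    using card_rac_classes_middle[of k n m even]
    by (simp add: rac_plus_def canonical_fps_def middle_satisfies_def)
  have rac: "int (rac k n m) = canonical_fps (\<lambda>_. True) m k $ n"
    using card_rac_classes_middle[of k n m "\<lambda>_. True"]
    by (simp add: rac_def canonical_fps_def middle_satisfies_def)
  have "middle_fps even = Abs_fps (\<lambda>n. if 2 dvd n then 1 else 0)"
    unfolding middle_fps_def by (rule arg_cong[where f = Abs_fps]) auto
  then have middle_even: "middle_fps even = ?M"
    by (simp add: geometric_fps_X_power)
  have middle_any: "middle_fps (\<lambda>_. True) = ?Q"
    by (simp add: middle_fps_def geometric_def)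
  have M: "?M * (1 - fps_X ^ 2) = 1"
    by (rule geometric_mult_one_minus) simp
  have Z: "?Z = fps_X ^ 2 * (1 + ?Q - ?P)"
    using one_minus_fps_X_power_geometric[OF assms] by simp
  \<comment> \<open>The even middle part clears the denominator \<open>1 - x\<^sup>2\<close>.\<close>
  have "?M * geometric ?B = geometric ?Z"
  proof (rule geometric_unique)
    have "?M * (1 - ?Z) = ?M * (1 - fps_X ^ 2) - ?B"
      unfolding Z by (simp add: algebra_simps)
    also have "\<dots> = 1 - ?B"
      unfolding M ..
    finally have reduced: "?M * (1 - ?Z) = 1 - ?B" .
    have "?M * geometric ?B * (1 - ?Z) = geometric ?B * (?M * (1 - ?Z))"
      by (rule trans[OF arg_cong[where f = "\<lambda>t. t * _", OF mult.commute] mult.assoc])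
    also have "\<dots> = geometric ?B * (1 - ?B)"
      unfolding reduced ..
    also have "\<dots> = 1"
      by (rule geometric_mult_one_minus) simp
    finally show "?M * geometric ?B * (1 - ?Z) = 1" .
  qed simp
  from this[symmetric] have "canonical_fps even m k = geometric ?Z ^ Suc k * (?P ^ k * fps_X ^ (2 * k))"
    unfolding canonical_fps_eq[OF assms] middle_even
    by (simp only: power_mult_distrib power_mult power_Suc mult_ac[where ?'a = "int fps"])
  moreover have "fps_X ^ 3 * (1 - fps_X ^ (m - 1)) * ?Q * ?M * ?P = ?B"
    unfolding one_minus_fps_X_power_geometric[OF assms, symmetric]
    by (simp add: power3_eq_cube power2_eq_square mult_ac)
  then have "canonical_fps (\<lambda>_. True) m k
      = geometric (fps_X ^ 3 * (1 - fps_X ^ (m - 1)) * ?Q * ?M * ?P) ^ Suc k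
        * (?Q * ?M ^ k * ?P ^ k * fps_X ^ (2 * k))"
    unfolding canonical_fps_eq[OF assms] middle_any
    by (simp only: power_mult_distrib power_mult power_Suc mult_ac[where ?'a = "int fps"])
  ultimately show ?thesis
    unfolding rac_plus rac rac_plus_sum_eq_coefficient[OF assms] rac_plus_multinomial_sum_eq_coefficient[OF assms]
      rac_sum_eq_coefficient[OF assms]
    by simp
qed

end
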